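(* For positive integers $a, b$ define $$P_{ab}(x,y,z) = a^2y^2z+abxyz+aby^3+b^2xy^2+ax^2z+axy^2-2ayz^2+2bx^2y-bxz^2-by^2z+x^3-3xyz+y^3+z^3,$$ and let $F_{ab}:\mathbb{Z}^3\to\mathbb{Z}^3$ be the bijection $F_{ab}(x,y,z) = (y, z, az + by + x)$ (one step forward of the recurrence $u(n) = a\,u(n-1) + b\,u(n-2) + u(n-3)$), with inverse $F_{ab}^{-1}(x,y,z) = (z - ay - bx, x, y)$. For every positive integer $b$ there exists $A(b)$ such that for every integer $a \ge A(b)$ for which $X^3 - aX^2 - bX - 1$ is irreducible over $\mathbb{Q}$ and has a unique root of largest absolute value, which is real and greater than $1$, the following holds: there is a finite set $\mathcal{F}$ of integer solutions of $P_{ab} = 1$ such that every integer solution $(x,y,z)$ of $P_{ab}(x,y,z) = 1$ is of the form $F_{ab}^n(s)$ for some $s \in \mathcal{F}$ and some integer $n$.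
   Context: For $n \ge 0$, $F_{ab}^n$ is the $n$-fold composition of $F_{ab}$ and $F_{ab}^{-n}$ the $n$-fold composition of $F_{ab}^{-1}$. *)

theory Defs
  imports Complex_Main "HOL-Computational_Algebra.Computational_Algebra"
begin

fun P :: "int \<Rightarrow> int \<Rightarrow> int \<times> int \<times> int \<Rightarrow> int" where
  "P a b (x, y, z) =
     a\<^sup>2 * y\<^sup>2 * z + a * b * x * y * z + a * b * y ^ 3 + b\<^sup>2 * x * y\<^sup>2
     + a * x\<^sup>2 * z + a * x * y\<^sup>2 - 2 * a * y * z\<^sup>2 + 2 * b * x\<^sup>2 * y
     - b * x * z\<^sup>2 - b * y\<^sup>2 * z + x ^ 3 - 3 * x * y * z + y ^ 3 + z ^ 3"

fun F :: "int \<Rightarrow> int \<Rightarrow> int \<times> int \<times> int \<Rightarrow> int \<times> int \<times> int" where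
  "F a b (x, y, z) = (y, z, a * z + b * y + x)"

fun F_inv :: "int \<Rightarrow> int \<Rightarrow> int \<times> int \<times> int \<Rightarrow> int \<times> int \<times> int" where
  "F_inv a b (x, y, z) = (z - a * y - b * x, x, y)"

lemma F_inv_F: "F_inv a b (F a b s) = s"
  by (cases s) simp

lemma F_F_inv: "F a b (F_inv a b s) = s"
  by (cases s) simp

lemma bij_F: "bij (F a b)"
  by (rule bijI'; metis F_inv_F F_F_inv)

lemma inv_F: "inv (F a b) = F_inv a b"
  by (rule inv_equality) (simp_all add: F_inv_F F_F_inv)

definition F_pow :: "int \<Rightarrow> int \<Rightarrow> int \<Rightarrow> int \<times> int \<times> int \<Rightarrow> int \<times> int \<times> int" where
  "F_pow a b n = (if 0 \<le> n then F a b ^^ nat n else F_inv a b ^^ nat (- n))"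

definition rec_poly :: "int \<Rightarrow> int \<Rightarrow> int poly" where
  "rec_poly a b = [:-1, -b, -a, 1:]"

definition unique_largest_root :: "complex poly \<Rightarrow> complex \<Rightarrow> bool" where
  "unique_largest_root p r \<longleftrightarrow>
     poly p r = 0 \<and> (\<forall>w. poly p w = 0 \<and> w \<noteq> r \<longrightarrow> cmod w < cmod r)"

end

theory Submission
  imports Defs
begin

text \<open>
  \<open>P a b\<close> is the norm form of the cubic algebra defined by \<open>X\<^sup>3 - a X\<^sup>2 - b X - 1\<close>, and \<open>F a b\<close> is
  multiplication by a root, a unit of norm 1. For \<open>a \<ge> (b + 1)\<^sup>2\<close> only one root \<open>r\<close> is real, so \<open>P\<close>
  factors over the reals as \<open>L * Q\<close>, with \<open>L\<close> a linear form and \<open>Q\<close> the squared modulus of a complex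
  linear form, and \<open>F\<close> multiplies \<open>L\<close> by \<open>r > 1\<close>. Every solution of \<open>P = 1\<close> can therefore be moved by
  a power of \<open>F\<close> into the region \<open>1 \<le> L \<le> r\<close>; there \<open>Q \<le> 1\<close> as well, and the two bounds
  confine the solution to a bounded box.
\<close>

text \<open>For a root \<open>r\<close>, \<open>b + 1 / r\<close> equals r^2 - a r, so the
  coefficients (1, r^2 - a r, r) form a left eigenvector of the matrix of \<open>F\<close>, with
  eigenvalue \<open>r\<close>.\<close>

fun real_factor :: "int \<Rightarrow> real \<Rightarrow> int \<times> int \<times> int \<Rightarrow> real" where
  "real_factor b r (x, y, z) = x + (b + 1 / r) * y + r * z"

text \<open>
  The remaining two roots are \<open>u \<plusminus> i v\<close> with \<open>2 u = a - r\<close> and \<open>u\<^sup>2 + v\<^sup>2 = 1 / r\<close>; the form below is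
  \<open>|x + (w\<^sup>2 - a w) y + w z|\<^sup>2\<close> at \<open>w = u + i v\<close>, simplified by \<open>w\<^sup>2 - a w = b + 1 / w\<close>.
\<close>

fun complex_factor :: "int \<Rightarrow> int \<Rightarrow> real \<Rightarrow> int \<times> int \<times> int \<Rightarrow> real" where
  "complex_factor a b r (x, y, z) =
     (x + b * y + (a - r) / 2 * (r * y + z))\<^sup>2 + (1 / r - ((a - r) / 2)\<^sup>2) * (z - r * y)\<^sup>2"

lemma P_factorization:
  fixes r :: real
  assumes "r > 0" and root: "r ^ 3 = a * r\<^sup>2 + b * r + 1"
  shows "P a b s = real_factor b r s * complex_factor a b r s"
proof -
  obtain x y z where s: "s = (x, y, z)" by (cases s)
  define e where "e = 1 / r"
  have re: "r * e = 1" using \<open>r > 0\<close> by (simp add: e_def)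
  have a: "real_of_int a = r - b * e - e\<^sup>2" using root re by algebra
  have u: "(a - r) / 2 = - (b * e + e\<^sup>2) / 2" using a by simp
  define X Y Z A B where "X = real_of_int x" and "Y = real_of_int y" and "Z = real_of_int z"
    and "A = real_of_int a" and "B = real_of_int b"
  have "real_of_int (P a b s) =
     A\<^sup>2 * Y\<^sup>2 * Z + A * B * X * Y * Z + A * B * Y ^ 3 + B\<^sup>2 * X * Y\<^sup>2
     + A * X\<^sup>2 * Z + A * X * Y\<^sup>2 - 2 * A * Y * Z\<^sup>2 + 2 * B * X\<^sup>2 * Y
     - B * X * Z\<^sup>2 - B * Y\<^sup>2 * Z + X ^ 3 - 3 * X * Y * Z + Y ^ 3 + Z ^ 3"
    by (simp add: s X_def Y_def Z_def A_def B_def)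
  also have "\<dots> = (X + (B + e) * Y + r * Z) *
     ((X + B * Y + (- (B * e + e\<^sup>2) / 2) * (r * Y + Z))\<^sup>2
       + (e - (- (B * e + e\<^sup>2) / 2)\<^sup>2) * (Z - r * Y)\<^sup>2)"
  proof -
    \<comment> \<open>\<open>h\<close> is the common real part of the two other roots. By Vieta, the
      sum of the roots is \<open>A = r + 2 * h\<close> and the sum of their pairwise products is
      \<open>-B = 2 * h * r + e\<close>. Eliminating \<open>A\<close> and \<open>B\<close> leaves a
      polynomial identity in which \<open>r * e = 1\<close> is the only relation.\<close>
    define h where "h = - (B * e + e\<^sup>2) / 2"
    have h: "2 * h = - (B * e + e\<^sup>2)" by (simp add: h_def)
    have "A = r + 2 * h" using a h by (simp add: A_def B_def)
    moreover have "B = - 2 * h * r - e" using h re by algebra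
    ultimately show ?thesis unfolding h_def[symmetric] using re by algebra
  qed
  also have "\<dots> = real_factor b r s * complex_factor a b r s"
    by (simp add: s u X_def Y_def Z_def B_def flip: e_def)
  finally show ?thesis .
qed

lemma real_factor_F:
  fixes r :: real
  assumes "r > 0" and "r ^ 3 = a * r\<^sup>2 + b * r + 1"
  shows "real_factor b r (F a b s) = r * real_factor b r s"
proof -
  obtain x y z where s: "s = (x, y, z)" by (cases s)
  define e where "e = 1 / r"
  have re: "r * e = 1" using \<open>r > 0\<close> by (simp add: e_def)
  have "r\<^sup>2 = a * r + b + e" using assms(2) re by algebra
  then show ?thesis using re by (simp add: s flip: e_def) algebra
qed

lemma real_factor_F_pow:
  fixes r :: real
  assumes "r > 0" and "r ^ 3 = a * r\<^sup>2 + b * r + 1"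
  shows "real_factor b r (F_pow a b n s) = r powi n * real_factor b r s"
proof -
  have forward: "real_factor b r ((F a b ^^ k) s) = r ^ k * real_factor b r s" for k
    by (induction k) (simp_all add: real_factor_F[OF assms])
  have F_inv: "real_factor b r (F_inv a b t) = inverse r * real_factor b r t" for t
    using real_factor_F[OF assms, of "F_inv a b t"] \<open>r > 0\<close> by (simp add: F_F_inv)
  have backward: "real_factor b r ((F_inv a b ^^ k) s) = inverse r ^ k * real_factor b r s" for k
    by (induction k) (simp_all add: F_inv)
  show ?thesis by (simp add: F_pow_def power_int_def forward backward)
qed

lemma P_F: "P a b (F a b s) = P a b s"
  by (cases s) (simp add: algebra_simps power2_eq_square power3_eq_cube)

lemma P_F_pow: "P a b (F_pow a b n s) = P a b s"
proof -
  have forward: "P a b ((F a b ^^ k) s) = P a b s" for k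
    by (induction k) (simp_all add: P_F)
  have F_inv: "P a b (F_inv a b t) = P a b t" for t
    using P_F[of a b "F_inv a b t"] by (simp add: F_F_inv)
  have backward: "P a b ((F_inv a b ^^ k) s) = P a b s" for k
    by (induction k) (simp_all add: F_inv)
  show ?thesis by (simp add: F_pow_def forward backward)
qed

lemma F_pow_uminus: "F_pow a b n (F_pow a b (- n) s) = s"
proof -
  have "(F a b ^^ k) ((F_inv a b ^^ k) t) = t" for k t
    by (induction k arbitrary: t) (simp_all add: F_F_inv funpow_swap1[of "F_inv a b"])
  moreover have "(F_inv a b ^^ k) ((F a b ^^ k) t) = t" for k t
    by (induction k arbitrary: t) (simp_all add: F_inv_F funpow_swap1[of "F a b"])
  ultimately show ?thesis by (auto simp: F_pow_def)
qed

text \<open>The other two roots have real part (a - r) / 2 and product 1 / r, so the second claim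
  says that they are not real. The root equation, read as r^2 (r - a) = b r + 1, shows that
  \<open>r\<close> exceeds \<open>a\<close> by less than (b + 1) / r.\<close>

lemma complex_factor_discriminant:
  fixes a b :: int and r :: real
  assumes "b > 0" "a \<ge> (b + 1)\<^sup>2" "r > 1" "r ^ 3 = a * r\<^sup>2 + b * r + 1"
  shows "a < r" and "1 / r - ((a - r) / 2)\<^sup>2 > 0"
proof -
  have d: "r\<^sup>2 * (r - a) = b * r + 1"
    using assms(4) by (simp add: algebra_simps power2_eq_square power3_eq_cube)
  have "b * r + 1 > 0" using assms by (simp add: add_pos_pos)
  then show "a < r" using d \<open>r > 1\<close> by (metis diff_gt_0_iff_gt zero_less_mult_pos zero_less_power2 not_one_less_zero)
  have "r * (r * (r - a)) < r * (b + 1)"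
    using d assms by (simp add: algebra_simps power2_eq_square)
  then have le: "r * (r - a) < b + 1" using \<open>r > 1\<close> by simp
  \<comment> \<open>The threshold on \<open>a\<close> enters here: (b + 1)^2 \<le> a < r bounds the
    square by \<open>r\<close>, hence r (r - a)^2 < 1, which is stronger than the bound 4 that the
    discriminant requires.\<close>
  have "(r * (r - a))\<^sup>2 < (real_of_int b + 1)\<^sup>2"
    using le \<open>a < r\<close> \<open>r > 1\<close> by (intro power_strict_mono) auto
  also have "\<dots> \<le> a" using assms(2) by (metis of_int_1 of_int_add of_int_le_iff of_int_power)
  finally have "r\<^sup>2 * (r - a)\<^sup>2 < r" using \<open>a < r\<close> by (simp add: power_mult_distrib)
  then have "r * (r * (r - a)\<^sup>2) < r * 1" by (simp add: power2_eq_square mult.assoc)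
  then have "r * (r - a)\<^sup>2 < 1" using \<open>r > 1\<close> by simp
  then have "r * (r - a)\<^sup>2 < 4" by simp
  then have "(r - a)\<^sup>2 < 4 / r" using \<open>r > 1\<close> by (simp add: field_simps)
  then show "1 / r - ((a - r) / 2)\<^sup>2 > 0" by (simp add: power_divide power2_commute)
qed

text \<open>The two bounds control three independent real linear forms: the real factor and the two
  forms squared in the complex factor. Hence each coordinate is bounded, and a bounded box holds
  finitely many integer points.\<close>

lemma bounded_factors_finite:
  fixes r c d :: real
  assumes "r > 0" "a < r" and v: "1 / r - ((a - r) / 2)\<^sup>2 > 0"
  shows "finite {s. \<bar>real_factor b r s\<bar> \<le> c \<and> complex_factor a b r s \<le> d}" (is "finite ?S")
proof -
  define e where "e = 1 / r"
  define u where "u = (a - r) / 2"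
  define v where "v = e - u\<^sup>2"
  define m where "m = sqrt d"
  define N where "N = sqrt (d / v)"
  \<comment> \<open>\<open>k\<close> equals (r - u)^2 + v, the squared distance from
    \<open>r\<close> to u + i sqrt v; here \<open>v\<close> is the square of the imaginary
    part.\<close>
  define k where "k = e - 2 * u * r + r\<^sup>2"
  have "e > 0" "v > 0" using assms by (simp_all add: e_def u_def v_def)
  have "u < 0" using assms by (simp add: u_def)
  then have "u * r < 0" using \<open>r > 0\<close> by (simp add: mult_neg_pos)
  then have "k > 0" using \<open>e > 0\<close> unfolding k_def by (simp add: add_pos_nonneg)
  define Y where "Y = (c + m + (r - u) * N) / k"
  define Z where "Z = N + r * Y"
  define X where "X = c + \<bar>b + e\<bar> * Y + r * Z"
  have box: "\<bar>x\<bar> \<le> X \<and> \<bar>y\<bar> \<le> Y \<and> \<bar>z\<bar> \<le> Z" if "(x, y, z) \<in> ?S" for x y z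
  proof -
    define l where "l = x + (b + e) * y + r * z"
    define p where "p = x + b * y + u * (r * y + z)"
    define q where "q = z - r * y"
    have l: "\<bar>l\<bar> \<le> c" using that by (simp add: l_def e_def)
    have pq: "p\<^sup>2 + v * q\<^sup>2 \<le> d" using that by (simp add: p_def q_def v_def u_def e_def)
    have "v * q\<^sup>2 \<ge> 0" using \<open>v > 0\<close> by simp
    then have "p\<^sup>2 \<le> d" using pq by linarith
    then have p: "\<bar>p\<bar> \<le> m" unfolding m_def by (metis real_sqrt_abs real_sqrt_le_iff)
    have "v * q\<^sup>2 \<le> d" using pq by (smt (verit) zero_le_power2)
    then have "q\<^sup>2 \<le> d / v" using \<open>v > 0\<close> by (simp add: field_simps)
    then have q: "\<bar>q\<bar> \<le> N" unfolding N_def by (metis real_sqrt_abs real_sqrt_le_iff)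
    \<comment> \<open>Subtracting \<open>p\<close> cancels x, and the multiple of \<open>q\<close>
      then cancels z.\<close>
    have "k * y = l - p - (r - u) * q"
      by (simp add: k_def l_def p_def q_def algebra_simps power2_eq_square)
    then have "\<bar>k * y\<bar> \<le> \<bar>l\<bar> + \<bar>p\<bar> + \<bar>(r - u) * q\<bar>" by linarith
    also have "\<dots> \<le> c + m + (r - u) * N"
      using l p q \<open>u < 0\<close> \<open>r > 0\<close> by (intro add_mono) (simp_all add: abs_mult)
    finally have y: "\<bar>y\<bar> \<le> Y" using \<open>k > 0\<close> by (simp add: Y_def abs_mult field_simps)
    have "real_of_int z = q + r * y" by (simp add: q_def)
    then have "\<bar>z\<bar> \<le> \<bar>q\<bar> + r * \<bar>y\<bar>" using \<open>r > 0\<close> by (metis abs_mult abs_of_pos abs_triangle_ineq of_int_abs)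
    also have "\<dots> \<le> Z" unfolding Z_def using q y \<open>r > 0\<close> by (intro add_mono) simp_all
    finally have z: "\<bar>z\<bar> \<le> Z" .
    have "real_of_int x = l - (b + e) * y - r * z" by (simp add: l_def)
    then have "\<bar>real_of_int x\<bar> \<le> \<bar>l\<bar> + \<bar>(b + e) * y\<bar> + \<bar>r * z\<bar>" by linarith
    also have "\<dots> \<le> X" unfolding X_def
      using l y z \<open>r > 0\<close> by (intro add_mono) (simp_all add: abs_mult mult_left_mono)
    finally show ?thesis using y z by simp
  qed
  have "?S \<subseteq> {-\<lfloor>X\<rfloor>..\<lfloor>X\<rfloor>} \<times> {-\<lfloor>Y\<rfloor>..\<lfloor>Y\<rfloor>} \<times> {-\<lfloor>Z\<rfloor>..\<lfloor>Z\<rfloor>}"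
  proof
    fix s assume "s \<in> ?S"
    then obtain x y z where s: "s = (x, y, z)" and "(x, y, z) \<in> ?S" by (cases s) auto
    then have "\<bar>x\<bar> \<le> \<lfloor>X\<rfloor> \<and> \<bar>y\<bar> \<le> \<lfloor>Y\<rfloor> \<and> \<bar>z\<bar> \<le> \<lfloor>Z\<rfloor>"
      using box by (simp add: le_floor_iff)
    then show "s \<in> {-\<lfloor>X\<rfloor>..\<lfloor>X\<rfloor>} \<times> {-\<lfloor>Y\<rfloor>..\<lfloor>Y\<rfloor>} \<times> {-\<lfloor>Z\<rfloor>..\<lfloor>Z\<rfloor>}"
      by (auto simp: s)
  qed
  then show ?thesis by (rule finite_subset) simp
qed

lemma P_solutions_finite_orbits:
  fixes r :: real
  assumes "b > 0" "a \<ge> (b + 1)\<^sup>2" "r > 1" and root: "r ^ 3 = a * r\<^sup>2 + b * r + 1"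
  shows "\<exists>S. finite S \<and> S \<subseteq> {s. P a b s = 1} \<and>
           (\<forall>s. P a b s = 1 \<longrightarrow> (\<exists>t\<in>S. \<exists>n. s = F_pow a b n t))"
proof -
  have "r > 0" using \<open>r > 1\<close> by simp
  note disc = complex_factor_discriminant[OF assms]
  have nonneg: "complex_factor a b r s \<ge> 0" for s
    using disc by (cases s) simp
  have product: "real_factor b r s * complex_factor a b r s = 1" if "P a b s = 1" for s
    using P_factorization[OF \<open>r > 0\<close> root, of s] that by simp
  \<comment> \<open>A product equal to 1 with one factor nonnegative forces the other to be
    positive, so the logarithm below is taken of a positive number.\<close>
  have pos: "real_factor b r s > 0" if "P a b s = 1" for s
    using product[OF that] nonneg[of s] by (metis order_le_less zero_less_mult_pos2 zero_less_one mult_zero_right zero_neq_one)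
  define S where "S = {s. P a b s = 1 \<and> 1 \<le> real_factor b r s \<and> real_factor b r s \<le> r}"
  have "S \<subseteq> {s. \<bar>real_factor b r s\<bar> \<le> r \<and> complex_factor a b r s \<le> 1}"
  proof
    fix s assume s: "s \<in> S"
    then have "1 * complex_factor a b r s \<le> real_factor b r s * complex_factor a b r s"
      by (intro mult_right_mono nonneg) (simp add: S_def)
    then show "s \<in> {s. \<bar>real_factor b r s\<bar> \<le> r \<and> complex_factor a b r s \<le> 1}"
      using s product[of s] by (simp add: S_def)
  qed
  then have "finite S"
    by (rule finite_subset) (rule bounded_factors_finite[OF \<open>r > 0\<close> disc])
  moreover have "\<exists>t\<in>S. \<exists>n. s = F_pow a b n t" if "P a b s = 1" for s
  proof -
    \<comment> \<open>This \<open>n\<close> places the real factor between r^n and r^(n + 1).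
      Applying \<open>F\<close> to the power -n divides it by r^n and lands in
      \<open>S\<close>.\<close>
    define n where "n = \<lfloor>log r (real_factor b r s)\<rfloor>"
    have "r powr n \<le> r powr (log r (real_factor b r s))" "r powr (log r (real_factor b r s)) \<le> r powr (n + 1)"
      using \<open>r > 1\<close> unfolding n_def by (intro powr_mono; linarith)+
    then have "r powi n \<le> real_factor b r s" "real_factor b r s \<le> r powi n * r"
      using \<open>r > 1\<close> pos[OF that] by (simp_all add: powr_add powr_real_of_int')
    then have "1 \<le> real_factor b r s / r powi n" "real_factor b r s / r powi n \<le> r"
      using \<open>r > 0\<close> by (simp_all add: le_divide_eq divide_le_eq mult.commute)
    then have "F_pow a b (- n) s \<in> S"
      using that real_factor_F_pow[OF \<open>r > 0\<close> root, of "- n" s]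
      by (simp add: S_def P_F_pow power_int_minus divide_inverse_commute)
    then show ?thesis by (metis F_pow_uminus)
  qed
  ultimately show ?thesis by (intro exI[of _ S]) (auto simp: S_def)
qed

lemma real_root_rec_poly:
  assumes "poly (map_poly complex_of_int (rec_poly a b)) (complex_of_real r) = 0"
  shows "r ^ 3 = a * r\<^sup>2 + b * r + 1"
proof -
  have "poly (map_poly complex_of_int (rec_poly a b)) (complex_of_real r)
      = complex_of_real (r ^ 3 - a * r\<^sup>2 - b * r - 1)"
    by (simp add: rec_poly_def map_poly_pCons algebra_simps power2_eq_square power3_eq_cube)
  then have "r ^ 3 - a * r\<^sup>2 - b * r - 1 = 0" using assms by (metis of_real_eq_0_iff)
  then show ?thesis by simp
qed

theorem theorem4p4:
  fixes b :: int
  assumes "b > 0"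
  shows "\<exists>A::int. \<forall>a::int. a > 0 \<and> a \<ge> A \<and>
           irreducible (map_poly rat_of_int (rec_poly a b)) \<and>
           (\<exists>r::real. r > 1 \<and>
              unique_largest_root (map_poly complex_of_int (rec_poly a b)) (complex_of_real r)) \<longrightarrow>
           (\<exists>S. finite S \<and> S \<subseteq> {s. P a b s = 1} \<and>
              (\<forall>x y z. P a b (x, y, z) = 1 \<longrightarrow>
                 (\<exists>s\<in>S. \<exists>n::int. (x, y, z) = F_pow a b n s)))"
\<comment> \<open>The witness is the threshold of \<open>complex_factor_discriminant\<close>, above
  which \<open>r\<close> is the only real root.\<close>
proof (intro exI[of _ "(b + 1)\<^sup>2"] allI impI)
  fix a :: int
  assume a: "a > 0 \<and> a \<ge> (b + 1)\<^sup>2 \<and>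
           irreducible (map_poly rat_of_int (rec_poly a b)) \<and>
           (\<exists>r::real. r > 1 \<and>
              unique_largest_root (map_poly complex_of_int (rec_poly a b)) (complex_of_real r))"
  then obtain r :: real where "r > 1" "r ^ 3 = a * r\<^sup>2 + b * r + 1"
    using real_root_rec_poly unfolding unique_largest_root_def by blast
  with a assms show "\<exists>S. finite S \<and> S \<subseteq> {s. P a b s = 1} \<and>
              (\<forall>x y z. P a b (x, y, z) = 1 \<longrightarrow>
                 (\<exists>s\<in>S. \<exists>n::int. (x, y, z) = F_pow a b n s))"
    using P_solutions_finite_orbits[of b a r] by metis
qed

end
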